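(* Let $\mathscr{H}$ be a complex Hilbert space and let $T\in \mathbb{B}(\mathscr{H})$. Then $$\sqrt{\frac{1}{8} \|T^*T+TT^*\|+\frac14\left( \|Re(T)\|^2+\|Im(T)\|^2 \right)+\frac12\left|\|Re(T)\|^2-\|Im(T)\|^2\right|}\leq w(T).$$
   Context: $\mathbb{B}(\mathscr{H})$ denotes the bounded linear operators on $\mathscr{H}$, $\|\cdot\|$ the operator norm. $Re(T)=\frac12(T+T^* )$ and $Im(T)=\frac1{2i}(T-T^* )$. The numerical radius is $w(T)=\sup\{|\langle Tx,x\rangle| : x\in\mathscr{H},\ \|x\|=1\}$. *)

theory Defs
  imports "HOL-Analysis.Analysis"
begin

text \<open>
  The inner product is linear in its first argument. The last axiom says that the norm (hence the
  topology) of the underlying real normed space is the one induced by the inner product.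
\<close>

class complex_inner = real_normed_vector +
  fixes scaleC :: "complex \<Rightarrow> 'a \<Rightarrow> 'a" (infixr \<open>*\<^sub>C\<close> 75)
    and cinner :: "'a \<Rightarrow> 'a \<Rightarrow> complex" (\<open>\<langle>_, _\<rangle>\<close>)
  assumes scaleC_add_right: "a *\<^sub>C (x + y) = a *\<^sub>C x + a *\<^sub>C y"
    and scaleC_add_left: "(a + b) *\<^sub>C x = a *\<^sub>C x + b *\<^sub>C x"
    and scaleC_scaleC: "a *\<^sub>C b *\<^sub>C x = (a * b) *\<^sub>C x"
    and scaleC_one: "1 *\<^sub>C x = x"
    and scaleC_of_real: "complex_of_real r *\<^sub>C x = r *\<^sub>R x"
    and cinner_commute: "\<langle>x, y\<rangle> = cnj \<langle>y, x\<rangle>"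
    and cinner_add_left: "\<langle>x + y, z\<rangle> = \<langle>x, z\<rangle> + \<langle>y, z\<rangle>"
    and cinner_scaleC_left: "\<langle>a *\<^sub>C x, y\<rangle> = a * \<langle>x, y\<rangle>"
    and cinner_self_nonneg: "0 \<le> Re \<langle>x, x\<rangle>"
    and cinner_self_eq_zero: "\<langle>x, x\<rangle> = 0 \<longleftrightarrow> x = 0"
    and norm_eq_sqrt_cinner: "norm x = sqrt (Re \<langle>x, x\<rangle>)"

class chilbert_space = complex_inner + complete_space

subclass (in chilbert_space) banach ..

instantiation complex :: chilbert_space
begin

definition scaleC_complex :: "complex \<Rightarrow> complex \<Rightarrow> complex"
  where "scaleC_complex a x = a * x"

definition cinner_complex :: "complex \<Rightarrow> complex \<Rightarrow> complex"
  where "cinner_complex x y = x * cnj y"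

instance
  by standard
    (auto simp: scaleC_complex_def cinner_complex_def algebra_simps scaleR_conv_of_real
      cmod_def power2_eq_square)

end

definition bounded_clinear :: "('a::complex_inner \<Rightarrow> 'b::complex_inner) \<Rightarrow> bool"
  where "bounded_clinear T \<longleftrightarrow> bounded_linear T \<and> (\<forall>a x. T (a *\<^sub>C x) = a *\<^sub>C T x)"

text \<open>
  For bounded complex-linear \<open>T\<close> on a Hilbert space, the function described here exists and is
  unique by the Riesz representation theorem.
\<close>

definition adj :: "('a::chilbert_space \<Rightarrow> 'a) \<Rightarrow> 'a \<Rightarrow> 'a"
  where "adj T = (THE S. \<forall>x y. \<langle>T x, y\<rangle> = \<langle>x, S y\<rangle>)"

definition Re_op :: "('a::chilbert_space \<Rightarrow> 'a) \<Rightarrow> 'a \<Rightarrow> 'a"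
  where "Re_op T = (\<lambda>x. (1 / 2) *\<^sub>C (T x + adj T x))"

definition Im_op :: "('a::chilbert_space \<Rightarrow> 'a) \<Rightarrow> 'a \<Rightarrow> 'a"
  where "Im_op T = (\<lambda>x. (1 / (2 * \<i>)) *\<^sub>C (T x - adj T x))"

text \<open>
  The supremum is taken in the nonnegative reals: inserting \<open>0\<close> only matters on the zero space,
  which has no unit vectors and where the real supremum of the empty set would be unspecified.
\<close>

definition numerical_radius :: "('a::chilbert_space \<Rightarrow> 'a) \<Rightarrow> real"
  where "numerical_radius T = Sup (insert 0 {cmod \<langle>T x, x\<rangle> | x. norm x = 1})"

end

theory Submission imports Defs begin

text \<open>
  Write \<open>T = A + \<i> B\<close> with \<open>A = Re_op T\<close>, \<open>B = Im_op T\<close>, and \<open>a\<close>, \<open>b\<close> for their norms. Since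
  \<open>T\<^sup>* T + T T\<^sup>* = 2 (A\<^sup>2 + B\<^sup>2)\<close>, the radicand is at most
  \<open>(a\<^sup>2 + b\<^sup>2) / 2 + \<bar>a\<^sup>2 - b\<^sup>2\<bar> / 2 = max (a\<^sup>2) (b\<^sup>2)\<close>. The quadratic forms of \<open>A\<close> and \<open>B\<close>
  are the real and imaginary parts of that of \<open>T\<close>, and the norm of a self-adjoint operator is
  determined by its quadratic form, so \<open>a\<close> and \<open>b\<close> are both at most the numerical radius.
\<close>

section \<open>Algebra of the inner product and its norm\<close>

lemma cinner_add_right: "\<langle>x, y + z\<rangle> = \<langle>x, y\<rangle> + \<langle>x, z\<rangle>"
  for x :: "'a::complex_inner"
  by (metis cinner_commute cinner_add_left complex_cnj_add)

lemma cinner_scaleC_right: "\<langle>x, a *\<^sub>C y\<rangle> = cnj a * \<langle>x, y\<rangle>"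
  for x :: "'a::complex_inner"
  by (metis cinner_commute cinner_scaleC_left complex_cnj_mult)

lemma cinner_scaleR_left: "\<langle>r *\<^sub>R x, y\<rangle> = of_real r * \<langle>x, y\<rangle>"
  for x :: "'a::complex_inner"
  by (metis cinner_scaleC_left scaleC_of_real)

lemma cinner_scaleR_right: "\<langle>x, r *\<^sub>R y\<rangle> = of_real r * \<langle>x, y\<rangle>"
  for x :: "'a::complex_inner"
  by (metis cinner_scaleC_right scaleC_of_real complex_cnj_complex_of_real)

lemma cinner_minus_left: "\<langle>- x, y\<rangle> = - \<langle>x, y\<rangle>"
  for x :: "'a::complex_inner"
  using cinner_scaleR_left[of "-1" x y] by simp

lemma cinner_minus_right: "\<langle>x, - y\<rangle> = - \<langle>x, y\<rangle>"
  for x :: "'a::complex_inner"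
  using cinner_scaleR_right[of x "-1" y] by simp

lemma cinner_diff_left: "\<langle>x - y, z\<rangle> = \<langle>x, z\<rangle> - \<langle>y, z\<rangle>"
  for x :: "'a::complex_inner"
  using cinner_add_left[of x "- y" z] by (simp add: cinner_minus_left)

lemma cinner_diff_right: "\<langle>x, y - z\<rangle> = \<langle>x, y\<rangle> - \<langle>x, z\<rangle>"
  for x :: "'a::complex_inner"
  using cinner_add_right[of x y "- z"] by (simp add: cinner_minus_right)

lemmas cinner_simps = cinner_add_left cinner_add_right cinner_diff_left cinner_diff_right
  cinner_scaleR_left cinner_scaleR_right cinner_scaleC_left cinner_scaleC_right

lemma Re_cinner_commute: "Re \<langle>x, y\<rangle> = Re \<langle>y, x\<rangle>"
  for x :: "'a::complex_inner"
  by (metis cinner_commute complex_cnj(1) complex.sel(1) complex_surj)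

lemma power2_norm_eq_cinner: "(norm x)\<^sup>2 = Re \<langle>x, x\<rangle>"
  for x :: "'a::complex_inner"
  by (simp add: norm_eq_sqrt_cinner cinner_self_nonneg)

lemma power2_norm_add: "(norm (x + y))\<^sup>2 = (norm x)\<^sup>2 + 2 * Re \<langle>x, y\<rangle> + (norm y)\<^sup>2"
  for x :: "'a::complex_inner"
  using Re_cinner_commute[of x y] by (simp add: power2_norm_eq_cinner cinner_simps)

lemma power2_norm_diff: "(norm (x - y))\<^sup>2 = (norm x)\<^sup>2 - 2 * Re \<langle>x, y\<rangle> + (norm y)\<^sup>2"
  for x :: "'a::complex_inner"
  using Re_cinner_commute[of x y] by (simp add: power2_norm_eq_cinner cinner_simps)

text \<open>The class axioms give homogeneity of the norm directly only for real scalars; for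
  complex ones it comes from the factor \<open>a * cnj a\<close> in
  \<open>\<langle>a *\<^sub>C x, a *\<^sub>C x\<rangle>\<close>.\<close>

lemma norm_scaleC: "norm (a *\<^sub>C x) = cmod a * norm x"
  for x :: "'a::complex_inner"
proof -
  have "\<langle>a *\<^sub>C x, a *\<^sub>C x\<rangle> = of_real ((cmod a)\<^sup>2) * \<langle>x, x\<rangle>"
    by (simp add: cinner_simps complex_norm_square[of a, simplified])
  then have "(norm (a *\<^sub>C x))\<^sup>2 = (cmod a * norm x)\<^sup>2"
    by (simp add: power2_norm_eq_cinner power_mult_distrib)
  then show ?thesis by simp
qed

lemma scaleC_minus_right: "a *\<^sub>C (- x) = - (a *\<^sub>C x)"
  for x :: "'a::complex_inner"
  by (metis add.right_inverse add_cancel_left_right minus_unique scaleC_add_right)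

lemma scaleC_diff_right: "a *\<^sub>C (x - y) = a *\<^sub>C x - a *\<^sub>C y"
  for x :: "'a::complex_inner"
  using scaleC_add_right[of a x "- y"] by (simp add: scaleC_minus_right)

lemma bounded_linear_scaleC: "bounded_linear (\<lambda>x :: 'a::complex_inner. a *\<^sub>C x)"
proof (rule bounded_linear_intro)
  show "a *\<^sub>C (r *\<^sub>R x) = r *\<^sub>R (a *\<^sub>C x)" for r and x :: 'a
    by (metis scaleC_of_real scaleC_scaleC mult.commute)
  show "norm (a *\<^sub>C x) \<le> norm x * cmod a" for x :: 'a
    by (simp add: norm_scaleC)
qed (rule scaleC_add_right)

section \<open>The Cauchy-Schwarz inequality and the Riesz representation theorem\<close>

lemma Re_cinner_le_norm: "Re \<langle>x, y\<rangle> \<le> norm x * norm y"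
  for x :: "'a::complex_inner"
proof (cases "x = 0 \<or> y = 0")
  case True
  then show ?thesis
    using cinner_scaleR_left[of 0 0 y] cinner_scaleR_right[of x 0 0] by auto
next
  case False
  \<comment> \<open>The weights give both vectors the same norm, so the expanded square has the
    positive factor \<open>norm x * norm y\<close>, which can be cancelled.\<close>
  have "0 \<le> (norm (norm y *\<^sub>R x - norm x *\<^sub>R y))\<^sup>2" by simp
  also have "\<dots> = 2 * (norm x * norm y) * (norm x * norm y - Re \<langle>x, y\<rangle>)"
    unfolding power2_norm_diff by (simp add: cinner_simps algebra_simps power2_eq_square)
  finally have "0 \<le> (norm x * norm y) * (norm x * norm y - Re \<langle>x, y\<rangle>)" by simp
  moreover have "0 < norm x * norm y" using False by simp
  ultimately have "0 \<le> norm x * norm y - Re \<langle>x, y\<rangle>" by (simp only: zero_le_mult_iff) linarith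
  then show ?thesis by simp
qed

text \<open>Rotating \<open>x\<close> by a unimodular scalar makes the inner product real and
  nonnegative without changing \<open>norm x\<close>, which reduces the claim to the bound on real
  parts.\<close>

lemma cmod_cinner_le_norm: "cmod \<langle>x, y\<rangle> \<le> norm x * norm y"
  for x :: "'a::complex_inner"
proof (cases "\<langle>x, y\<rangle> = 0")
  case False
  define c where "c = cnj (sgn \<langle>x, y\<rangle>)"
  have c: "cmod c = 1" using False by (simp add: c_def norm_sgn)
  have "c * \<langle>x, y\<rangle> = of_real (cmod \<langle>x, y\<rangle>)"
    using False complex_norm_square[of "\<langle>x, y\<rangle>"]
    by (simp add: c_def sgn_eq field_simps power2_eq_square)
  then have "cmod \<langle>x, y\<rangle> = Re \<langle>c *\<^sub>C x, y\<rangle>" by (simp add: cinner_simps)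
  also have "\<dots> \<le> norm (c *\<^sub>C x) * norm y" by (rule Re_cinner_le_norm)
  finally show ?thesis by (simp add: norm_scaleC c)
qed simp

lemma cinner_eqI:
  fixes y z :: "'a::complex_inner"
  assumes "\<And>x. \<langle>x, y\<rangle> = \<langle>x, z\<rangle>"
  shows "y = z"
proof -
  have "\<langle>y - z, y - z\<rangle> = 0" using assms[of "y - z"] by (simp add: cinner_diff_right)
  then show ?thesis by (simp add: cinner_self_eq_zero)
qed

text \<open>
  The representing vector minimises the energy \<open>J y = \<parallel>y\<parallel>\<^sup>2 - 2 g y\<close>; by the parallelogram law
  every minimising sequence is Cauchy.
\<close>

lemma real_riesz_representation:
  fixes g :: "'a::chilbert_space \<Rightarrow> real"
  assumes "bounded_linear g"
  obtains y where "\<And>x. g x = Re \<langle>x, y\<rangle>"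
proof -
  interpret g: bounded_linear g by fact
  define J where "J y = (norm y)\<^sup>2 - 2 * g y" for y
  obtain K where K: "\<And>x. norm (g x) \<le> norm x * K" using g.bounded by blast
  \<comment> \<open>Since \<open>g y \<le> K * norm y\<close>, completing the square gives
    \<open>J y \<ge> (norm y - K)^2 - K^2\<close>.\<close>
  have "- K\<^sup>2 \<le> J y" for y
  proof -
    have "0 \<le> (norm y - K)\<^sup>2" by simp
    then show ?thesis
      using K[of y] unfolding J_def by (simp add: power2_diff algebra_simps)
  qed
  then have bdd: "bdd_below (range J)" by (auto simp: bdd_below_def)
  define m where "m = Inf (range J)"
  have m_le: "m \<le> J y" for y unfolding m_def using bdd by (simp add: cInf_lower)
  have "\<exists>y. J y < m + inverse (real (Suc n))" for n
    using cInf_lessD[of "range J" "m + inverse (real (Suc n))"] by (auto simp: m_def)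
  then obtain X where X: "\<And>n. J (X n) < m + inverse (real (Suc n))" by metis
  \<comment> \<open>In the parallelogram law the linear terms in \<open>g\<close> cancel, and the
    value of \<open>J\<close> at the midpoint is at least \<open>m\<close>.\<close>
  have dist_le: "(norm (x - y))\<^sup>2 \<le> 2 * (J x - m) + 2 * (J y - m)" for x y
  proof -
    have "(norm (x - y))\<^sup>2 = 2 * J x + 2 * J y - 4 * J ((1/2) *\<^sub>R (x + y))"
      by (simp add: J_def power2_norm_diff power2_norm_add g.scaleR g.add power_mult_distrib
          cinner_simps field_simps)
    then show ?thesis using m_le[of "(1/2) *\<^sub>R (x + y)"] by simp
  qed
  have "Cauchy X"
  proof (rule metric_CauchyI)
    fix e :: real assume "0 < e"
    \<comment> \<open>Two values of \<open>J\<close> within \<open>d\<close> of \<open>m\<close>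
      bound the squared distance by \<open>4 * d\<close>, which is \<open>e^2\<close>.\<close>
    define d where "d = e\<^sup>2 / 4"
    have "0 < d" using \<open>0 < e\<close> by (simp add: d_def)
    then obtain N where N: "inverse (real (Suc N)) < d"
      using reals_Archimedean by blast
    have small: "J (X n) < m + d" if "N \<le> n" for n
    proof -
      have "J (X n) < m + inverse (real (Suc n))" by (rule X)
      also have "\<dots> \<le> m + inverse (real (Suc N))"
        using that by (simp add: le_imp_inverse_le)
      also have "\<dots> < m + d" using N by simp
      finally show ?thesis .
    qed
    have "dist (X p) (X q) < e" if "N \<le> p" "N \<le> q" for p q
    proof -
      have "(norm (X p - X q))\<^sup>2 < 4 * d"
        using dist_le[of "X p" "X q"] small[OF that(1)] small[OF that(2)] by simp
      then have "(norm (X p - X q))\<^sup>2 < e\<^sup>2" by (simp add: d_def)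
      then show ?thesis
        using \<open>0 < e\<close> by (simp add: dist_norm power_less_imp_less_base)
    qed
    then show "\<exists>M. \<forall>p\<ge>M. \<forall>q\<ge>M. dist (X p) (X q) < e" by blast
  qed
  then obtain y where y: "X \<longlonglongrightarrow> y" by (auto simp: Cauchy_convergent_iff convergent_def)
  \<comment> \<open>\<open>J\<close> is continuous, so the limit \<open>y\<close> attains the
    infimum.\<close>
  have "(\<lambda>n. J (X n)) \<longlonglongrightarrow> J y"
    unfolding J_def by (intro tendsto_intros g.tendsto y)
  moreover have "(\<lambda>n. m + inverse (real (Suc n))) \<longlonglongrightarrow> m + 0"
    by (intro tendsto_intros LIMSEQ_inverse_real_of_nat)
  ultimately have "J y \<le> m + 0"
    by (rule LIMSEQ_le) (use X less_imp_le in blast)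
  then have Jy: "J y \<le> J x" for x using m_le[of x] by linarith
  have "g x = Re \<langle>x, y\<rangle>" for x
  proof (rule ccontr)
    assume *: "g x \<noteq> Re \<langle>x, y\<rangle>"
    define d where "d = g x - Re \<langle>x, y\<rangle>"
    have "x \<noteq> 0" using * cinner_scaleR_left[of 0 x y] g.zero by auto
    then have x: "(norm x)\<^sup>2 > 0" by simp
    \<comment> \<open>This \<open>t\<close> minimises the quadratic polynomial
      \<open>J (y + t *\<^sub>R x)\<close>; if \<open>d\<close> is nonzero, its value there lies
      strictly below \<open>J y\<close>.\<close>
    define t where "t = d / (norm x)\<^sup>2"
    have "J (y + t *\<^sub>R x) = J y - 2 * t * d + t\<^sup>2 * (norm x)\<^sup>2"
      using Re_cinner_commute[of x y]
      by (simp add: J_def d_def power2_norm_add g.add g.scaleR cinner_simps power_mult_distrib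
          algebra_simps)
    also have "\<dots> = J y - d\<^sup>2 / (norm x)\<^sup>2"
      using x by (simp add: t_def field_simps power2_eq_square)
    finally have "d\<^sup>2 / (norm x)\<^sup>2 \<le> 0" using Jy[of "y + t *\<^sub>R x"] by simp
    moreover have "d\<^sup>2 / (norm x)\<^sup>2 > 0" using * x by (simp add: d_def)
    ultimately show False by simp
  qed
  then show thesis by (rule that)
qed

section \<open>Existence, uniqueness and boundedness of the adjoint\<close>

lemma bounded_linear_Re_cinner_left:
  assumes "bounded_linear T"
  shows "bounded_linear (\<lambda>x. Re \<langle>T x, y :: 'a::complex_inner\<rangle>)"
proof -
  have "bounded_linear (\<lambda>z. Re \<langle>z, y\<rangle>)"
  proof (rule bounded_linear_intro)
    show "norm (Re \<langle>z, y\<rangle>) \<le> norm z * norm y" for z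
      using cmod_cinner_le_norm[of z y] abs_Re_le_cmod[of "\<langle>z, y\<rangle>"] by simp
  qed (simp_all add: cinner_simps)
  from bounded_linear_compose[OF this assms] show ?thesis .
qed

context
  fixes T :: "'a::chilbert_space \<Rightarrow> 'a"
  assumes T: "bounded_clinear T"
begin

lemma bounded_clinear_imp_bounded_linear: "bounded_linear T"
  using T by (simp add: bounded_clinear_def)

lemma bounded_clinear_scaleC: "T (a *\<^sub>C x) = a *\<^sub>C T x"
  using T by (simp add: bounded_clinear_def)

text \<open>The real Riesz theorem matches only real parts. Replacing \<open>x\<close> by
  \<open>\<i> *\<^sub>C x\<close> turns real parts into negated imaginary parts, so these agree as
  well.\<close>

lemma adjoint_exists: "\<exists>S. \<forall>x y. \<langle>T x, y\<rangle> = \<langle>x, S y\<rangle>"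
proof -
  have "\<exists>z. \<forall>x. \<langle>T x, y\<rangle> = \<langle>x, z\<rangle>" for y
  proof -
    obtain z where z: "\<And>x. Re \<langle>T x, y\<rangle> = Re \<langle>x, z\<rangle>"
      using real_riesz_representation[OF bounded_linear_Re_cinner_left[OF bounded_clinear_imp_bounded_linear]]
      by blast
    have "Im \<langle>T x, y\<rangle> = Im \<langle>x, z\<rangle>" for x
      using z[of "\<i> *\<^sub>C x"] by (simp add: bounded_clinear_scaleC cinner_simps)
    with z show ?thesis by (auto intro: complex_eqI)
  qed
  then show ?thesis by metis
qed

text \<open>Inner products separate points, so the witness from \<open>adjoint_exists\<close> is
  unique and is the function that \<open>THE\<close> in \<open>adj\<close> selects.\<close>

lemma cinner_adj_right: "\<langle>x, adj T y\<rangle> = \<langle>T x, y\<rangle>"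
proof -
  obtain S where S: "\<forall>x y. \<langle>T x, y\<rangle> = \<langle>x, S y\<rangle>"
    using adjoint_exists ..
  have "adj T = S"
    unfolding adj_def
  proof (rule the_equality[where P = "\<lambda>S. \<forall>x y. \<langle>T x, y\<rangle> = \<langle>x, S y\<rangle>", OF S])
    fix R assume "\<forall>x y. \<langle>T x, y\<rangle> = \<langle>x, R y\<rangle>"
    with S have "R y = S y" for y by (intro cinner_eqI[of "R y"]) simp
    then show "R = S" ..
  qed
  with S show ?thesis by simp
qed

lemma cinner_adj_left: "\<langle>adj T x, y\<rangle> = \<langle>x, T y\<rangle>"
  by (metis cinner_adj_right cinner_commute)

lemma adj_add: "adj T (x + y) = adj T x + adj T y"
  by (rule cinner_eqI) (simp add: cinner_adj_right cinner_simps)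

lemma adj_scaleC: "adj T (a *\<^sub>C x) = a *\<^sub>C adj T x"
  by (rule cinner_eqI) (simp add: cinner_adj_right cinner_simps)

text \<open>Pairing \<open>adj T x\<close> with itself moves one factor back through
  \<open>T\<close>; Cauchy-Schwarz then gives the bound \<open>onorm T\<close> after cancelling one
  factor \<open>norm (adj T x)\<close>.\<close>

lemma bounded_linear_adj: "bounded_linear (adj T)"
proof (rule bounded_linear_intro)
  show "adj T (r *\<^sub>R x) = r *\<^sub>R adj T x" for r x
    by (metis adj_scaleC scaleC_of_real)
  show "norm (adj T x) \<le> norm x * onorm T" for x
  proof -
    have "(norm (adj T x))\<^sup>2 = Re \<langle>T (adj T x), x\<rangle>"
      by (simp add: power2_norm_eq_cinner cinner_adj_right)
    also have "\<dots> \<le> norm (T (adj T x)) * norm x"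
      by (rule Re_cinner_le_norm)
    also have "\<dots> \<le> onorm T * norm (adj T x) * norm x"
      by (intro mult_right_mono onorm bounded_clinear_imp_bounded_linear) simp
    finally have "norm (adj T x) * norm (adj T x) \<le> norm (adj T x) * (norm x * onorm T)"
      by (simp add: power2_eq_square mult_ac)
    then show ?thesis
      by (cases "adj T x = 0") (simp_all add: onorm_pos_le bounded_clinear_imp_bounded_linear)
  qed
qed (rule adj_add)

section \<open>The real and imaginary parts of an operator\<close>

lemma bounded_linear_Re_op: "bounded_linear (Re_op T)"
  unfolding Re_op_def
  by (intro bounded_linear_compose[OF bounded_linear_scaleC] bounded_linear_add
      bounded_clinear_imp_bounded_linear bounded_linear_adj)

lemma bounded_linear_Im_op: "bounded_linear (Im_op T)"
  unfolding Im_op_def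
  by (intro bounded_linear_compose[OF bounded_linear_scaleC] bounded_linear_sub
      bounded_clinear_imp_bounded_linear bounded_linear_adj)

lemma cinner_Re_op_symmetric: "\<langle>Re_op T x, y\<rangle> = \<langle>x, Re_op T y\<rangle>"
  by (simp add: Re_op_def cinner_simps cinner_adj_left cinner_adj_right)

lemma cinner_Im_op_symmetric: "\<langle>Im_op T x, y\<rangle> = \<langle>x, Im_op T y\<rangle>"
  by (simp add: Im_op_def cinner_simps cinner_adj_left cinner_adj_right algebra_simps)

text \<open>\<open>\<langle>adj T x, x\<rangle>\<close> is the conjugate of
  \<open>\<langle>T x, x\<rangle>\<close>, so averaging the two leaves the real part. The analogue
  for \<open>Im_op\<close> is the same with a difference.\<close>

lemma cinner_Re_op_self: "\<langle>Re_op T x, x\<rangle> = of_real (Re \<langle>T x, x\<rangle>)"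
  using cinner_commute[of x "T x"]
  by (simp add: Re_op_def cinner_simps cinner_adj_left complex_eq_iff)

lemma cinner_Im_op_self: "\<langle>Im_op T x, x\<rangle> = of_real (Im \<langle>T x, x\<rangle>)"
  using cinner_commute[of x "T x"]
  by (simp add: Im_op_def cinner_simps cinner_adj_left complex_eq_iff)

text \<open>The squares of \<open>Re_op T\<close> and \<open>Im_op T\<close> expand with prefactors
  1/4 and -1/4. In their sum the squares of \<open>T\<close> and \<open>adj T\<close> cancel, while
  each mixed product survives with coefficient 1/2.\<close>

lemma adj_comp_add_comp_adj:
  "adj T (T x) + T (adj T x) = 2 *\<^sub>R (Re_op T (Re_op T x) + Im_op T (Im_op T x))"
proof -
  interpret T: bounded_linear T by (rule bounded_clinear_imp_bounded_linear)
  interpret S: bounded_linear "adj T" by (rule bounded_linear_adj)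
  let ?c = "1 / (2 * \<i>)"
  have half: "(1/2) *\<^sub>C z = (1/2) *\<^sub>R z" for z :: 'a
    using scaleC_of_real[of "1/2" z] by simp
  have "Re_op T (Re_op T x) =
      (1/4) *\<^sub>R (T (T x) + T (adj T x) + adj T (T x) + adj T (adj T x))"
    by (simp add: Re_op_def half T.add T.scaleR S.add S.scaleR scaleR_add_right)
  moreover have "Im_op T (Im_op T x) =
      (- 1/4) *\<^sub>R (T (T x) - T (adj T x) - adj T (T x) + adj T (adj T x))"
  proof -
    have "Im_op T (Im_op T x) =
        ?c *\<^sub>C ?c *\<^sub>C (T (T x) - T (adj T x) - adj T (T x) + adj T (adj T x))"
      by (simp add: Im_op_def bounded_clinear_scaleC adj_scaleC T.diff S.diff scaleC_diff_right
          scaleC_add_right)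
    moreover have "?c * ?c = of_real (- 1/4)" by simp
    ultimately show ?thesis by (simp only: scaleC_scaleC scaleC_of_real)
  qed
  \<comment> \<open>Here \<open>p\<close>, \<open>v\<close>, \<open>u\<close>, \<open>q\<close>
    stand for \<open>T (T x)\<close>, \<open>T (adj T x)\<close>, \<open>adj T (T x)\<close>,
    \<open>adj T (adj T x)\<close>.\<close>
  moreover have "u + v = 2 *\<^sub>R ((1/4) *\<^sub>R (p + v + u + q) + (- 1/4) *\<^sub>R (p - v - u + q))"
    for p q u v :: 'a
  proof -
    have "2 *\<^sub>R ((1/4) *\<^sub>R (p + v + u + q) + (- 1/4) *\<^sub>R (p - v - u + q))
        = (1/2) *\<^sub>R ((p + v + u + q) - (p - v - u + q))"
      by (simp add: scaleR_add_right scaleR_diff_right)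
    also have "(p + v + u + q) - (p - v - u + q) = 2 *\<^sub>R (u + v)"
      by (simp add: scaleR_2)
    finally show ?thesis by simp
  qed
  ultimately show ?thesis by simp
qed

text \<open>This bounds the first summand of the radicand, with its factor 1/8, by the second
  one.\<close>

lemma onorm_adj_comp_add_comp_adj_le:
  "onorm (\<lambda>x. adj T (T x) + T (adj T x)) \<le> 2 * ((onorm (Re_op T))\<^sup>2 + (onorm (Im_op T))\<^sup>2)"
proof (rule onorm_bound)
  fix x
  have twice: "norm (A (A x)) \<le> (onorm A)\<^sup>2 * norm x" if A: "bounded_linear A"
    for A :: "'a \<Rightarrow> 'a"
  proof -
    have "norm (A (A x)) \<le> onorm A * norm (A x)" by (rule onorm[OF A])
    also have "\<dots> \<le> onorm A * (onorm A * norm x)"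
      by (intro mult_left_mono onorm onorm_pos_le A)
    finally show ?thesis by (simp add: power2_eq_square mult_ac)
  qed
  have "norm (adj T (T x) + T (adj T x))
      = 2 * norm (Re_op T (Re_op T x) + Im_op T (Im_op T x))"
    by (simp add: adj_comp_add_comp_adj)
  also have "\<dots> \<le> 2 * (norm (Re_op T (Re_op T x)) + norm (Im_op T (Im_op T x)))"
    by (rule mult_left_mono[OF norm_triangle_ineq]) simp
  also have "\<dots> \<le> 2 * ((onorm (Re_op T))\<^sup>2 * norm x + (onorm (Im_op T))\<^sup>2 * norm x)"
    by (intro mult_left_mono add_mono twice bounded_linear_Re_op bounded_linear_Im_op) simp
  finally show "norm (adj T (T x) + T (adj T x))
      \<le> 2 * ((onorm (Re_op T))\<^sup>2 + (onorm (Im_op T))\<^sup>2) * norm x"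
    by (simp add: algebra_simps)
qed simp

section \<open>The numerical radius as a bound for quadratic forms and norms\<close>

lemma bdd_above_numerical_range: "bdd_above (insert 0 {cmod \<langle>T x, x\<rangle> | x. norm x = 1})"
proof (rule bdd_aboveI)
  fix r assume "r \<in> insert 0 {cmod \<langle>T x, x\<rangle> | x. norm x = 1}"
  then consider "r = 0" | x where "norm x = 1" "r = cmod \<langle>T x, x\<rangle>" by blast
  then show "r \<le> onorm T"
  proof cases
    case 1
    then show ?thesis by (simp add: onorm_pos_le bounded_clinear_imp_bounded_linear)
  next
    case 2
    then show ?thesis
      using cmod_cinner_le_norm[of "T x" x] onorm[OF bounded_clinear_imp_bounded_linear, of x] by simp
  qed
qed

lemma numerical_radius_nonneg: "0 \<le> numerical_radius T"
  unfolding numerical_radius_def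
  by (rule cSup_upper[OF _ bdd_above_numerical_range]) simp

text \<open>Normalising \<open>x\<close> reduces this to unit vectors. The homogeneous form is what
  polarisation needs, since \<open>x + y\<close> and \<open>x - y\<close> are not
  normalised.\<close>

lemma cmod_cinner_le_numerical_radius: "cmod \<langle>T x, x\<rangle> \<le> numerical_radius T * (norm x)\<^sup>2"
proof (cases "x = 0")
  case True
  then show ?thesis using cinner_scaleR_right[of "T x" 0 x] by simp
next
  case False
  interpret T: bounded_linear T by (rule bounded_clinear_imp_bounded_linear)
  define u where "u = inverse (norm x) *\<^sub>R x"
  have u: "norm u = 1" and x: "x = norm x *\<^sub>R u" using False by (simp_all add: u_def)
  have "cmod \<langle>T u, u\<rangle> \<le> numerical_radius T"
    unfolding numerical_radius_def
    by (rule cSup_upper[OF _ bdd_above_numerical_range]) (use u in blast)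
  moreover have "cmod \<langle>T x, x\<rangle> = (norm x)\<^sup>2 * cmod \<langle>T u, u\<rangle>"
    by (subst (1 2) x) (simp add: T.scaleR cinner_simps norm_mult power2_eq_square)
  ultimately show ?thesis by (simp add: mult.commute mult_right_mono)
qed

end

text \<open>Polarisation recovers \<open>Re \<langle>A x, y\<rangle>\<close> from values of the
  quadratic form at \<open>x + y\<close> and \<open>x - y\<close>, and the parallelogram law
  controls the squared norms of these vectors.\<close>

lemma onorm_symmetric_le:
  fixes A :: "'a::complex_inner \<Rightarrow> 'a"
  assumes "linear A"
    and sym: "\<And>x y. \<langle>A x, y\<rangle> = \<langle>x, A y\<rangle>"
    and bound: "\<And>x. cmod \<langle>A x, x\<rangle> \<le> w * (norm x)\<^sup>2"
    and "0 \<le> w"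
  shows "onorm A \<le> w"
proof (rule onorm_bound)
  interpret A: linear A by fact
  fix x
  show "norm (A x) \<le> w * norm x"
  proof (cases "A x = 0")
    case True
    then show ?thesis using \<open>0 \<le> w\<close> by simp
  next
    case False
    \<comment> \<open>The direction of \<open>A x\<close> makes
      \<open>Re \<langle>A x, y\<rangle>\<close> as large as Cauchy-Schwarz allows; the length
      \<open>norm x\<close> lets a factor \<open>norm x\<close> cancel at the end.\<close>
    define y where "y = (norm x / norm (A x)) *\<^sub>R A x"
    have y: "norm y = norm x" using False by (simp add: y_def)
    have x: "norm x > 0" using False A.zero by auto
    have quad: "\<bar>Re \<langle>A z, z\<rangle>\<bar> \<le> w * (norm z)\<^sup>2" for z
      using bound[of z] abs_Re_le_cmod[of "\<langle>A z, z\<rangle>"] by linarith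
    have "Re \<langle>A x, y\<rangle> = norm x * norm (A x)"
      using False
      by (simp add: y_def cinner_simps power2_norm_eq_cinner[symmetric] power2_eq_square)
    moreover have "Re \<langle>A y, x\<rangle> = Re \<langle>A x, y\<rangle>"
      by (metis sym Re_cinner_commute)
    \<comment> \<open>The diagonal terms cancel in the difference; by symmetry the mixed terms are
      all equal, hence the factor 4.\<close>
    ultimately have "4 * (norm x * norm (A x))
        = Re \<langle>A (x + y), x + y\<rangle> - Re \<langle>A (x - y), x - y\<rangle>"
      by (simp add: A.add A.diff cinner_simps)
    also have "\<dots> \<le> w * (norm (x + y))\<^sup>2 + w * (norm (x - y))\<^sup>2"
      using quad[of "x + y"] quad[of "x - y"] by linarith
    also have "\<dots> = 4 * (norm x * (w * norm x))"
      unfolding power2_norm_add power2_norm_diff y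
      by (simp add: algebra_simps power2_eq_square)
    finally show ?thesis using x by simp
  qed
qed (rule \<open>0 \<le> w\<close>)

lemma onorm_Re_op_le_numerical_radius:
  assumes "bounded_clinear T"
  shows "onorm (Re_op T) \<le> numerical_radius T"
proof (rule onorm_symmetric_le)
  show "cmod \<langle>Re_op T x, x\<rangle> \<le> numerical_radius T * (norm x)\<^sup>2" for x
    using cmod_cinner_le_numerical_radius[OF assms, of x] abs_Re_le_cmod[of "\<langle>T x, x\<rangle>"]
    by (simp add: cinner_Re_op_self[OF assms])
qed (use assms in \<open>auto intro: bounded_linear.linear bounded_linear_Re_op
      cinner_Re_op_symmetric numerical_radius_nonneg\<close>)

lemma onorm_Im_op_le_numerical_radius:
  assumes "bounded_clinear T"
  shows "onorm (Im_op T) \<le> numerical_radius T"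
proof (rule onorm_symmetric_le)
  show "cmod \<langle>Im_op T x, x\<rangle> \<le> numerical_radius T * (norm x)\<^sup>2" for x
    using cmod_cinner_le_numerical_radius[OF assms, of x] abs_Im_le_cmod[of "\<langle>T x, x\<rangle>"]
    by (simp add: cinner_Im_op_self[OF assms])
qed (use assms in \<open>auto intro: bounded_linear.linear bounded_linear_Im_op
      cinner_Im_op_symmetric numerical_radius_nonneg\<close>)

theorem corollary2p5:
  fixes T :: "'a::chilbert_space \<Rightarrow> 'a"
  assumes "bounded_clinear T"
  shows "sqrt (1 / 8 * onorm (\<lambda>x. adj T (T x) + T (adj T x))
           + 1 / 4 * ((onorm (Re_op T))\<^sup>2 + (onorm (Im_op T))\<^sup>2)
           + 1 / 2 * \<bar>(onorm (Re_op T))\<^sup>2 - (onorm (Im_op T))\<^sup>2\<bar>)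
         \<le> numerical_radius T"
proof (rule real_le_lsqrt)
  have "(onorm (Re_op T))\<^sup>2 \<le> (numerical_radius T)\<^sup>2"
    by (intro power_mono onorm_Re_op_le_numerical_radius onorm_pos_le bounded_linear_Re_op assms)
  moreover have "(onorm (Im_op T))\<^sup>2 \<le> (numerical_radius T)\<^sup>2"
    by (intro power_mono onorm_Im_op_le_numerical_radius onorm_pos_le bounded_linear_Im_op assms)
  ultimately show "1 / 8 * onorm (\<lambda>x. adj T (T x) + T (adj T x))
           + 1 / 4 * ((onorm (Re_op T))\<^sup>2 + (onorm (Im_op T))\<^sup>2)
           + 1 / 2 * \<bar>(onorm (Re_op T))\<^sup>2 - (onorm (Im_op T))\<^sup>2\<bar> \<le> (numerical_radius T)\<^sup>2"
    \<comment> \<open>What remains is linear in the squared norms: for either sign of the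
      difference, the bound for the radicand collapses to the larger square.\<close>
    using onorm_adj_comp_add_comp_adj_le[OF assms] by argo
qed (rule numerical_radius_nonneg[OF assms])

end
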